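(* Let $(X,\mathcal{T})$ be a topological space, $\mathcal{B}$ a basis for $\mathcal{T}$ closed under finite unions, $i$ an initial interpretation, $\mathcal{M}_1=\langle X,\mathcal{T},i\rangle$ and $\mathcal{M}_2=\langle X,\mathcal{B},i\rangle$. Then for every formula $\phi$, $\phi$ is valid in $\mathcal{M}_1$ if and only if $\phi$ is valid in $\mathcal{M}_2$.
   Context: Formulas are built from a countable set $\mathsf{A}$ of atomic formulas (containing $\top,\bot$) by $\land,\neg,\Box,\mathsf{K}$. An initial interpretation is a map $i:\mathsf{A}\to\mathcal{P}(X)$ with $i(\top)=X$, $i(\bot)=\emptyset$. For a family $\mathcal{O}\subseteq\mathcal{P}(X)$, satisfaction in $\langle X,\mathcal{O},i\rangle$ is defined on pairs $(x,U)$ with $U\in\mathcal{O}$, $x\in U$: $x,U\models A$ iff $x\in i(A)$; Boolean connectives as usual; $x,U\models\mathsf{K}\phi$ iff $y,U\models\phi$ for all $y\in U$; $x,U\models\Box\phi$ iff $x,V\models\phi$ for all $V\in\mathcal{O}$ with $V\subseteq U$ and $x\in V$. A formula is valid in the model if it is satisfied at all such pairs. *)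

theory Defs
  imports "HOL-Analysis.Analysis"
begin

datatype 'a formula =
    Atom 'a
  | Conj "'a formula" "'a formula"
  | Neg "'a formula"
  | Box "'a formula"
  | Know "'a formula"

text \<open>Atomic formulas are the elements of a countable type, with two designated elements
  \<open>tt\<close> and \<open>ff\<close> playing the roles of $\top$ and $\bot$.\<close>

definition initial_interpretation ::
    "'x set \<Rightarrow> 'a \<Rightarrow> 'a \<Rightarrow> ('a \<Rightarrow> 'x set) \<Rightarrow> bool" where
  "initial_interpretation X tt ff i \<longleftrightarrow> (\<forall>a. i a \<subseteq> X) \<and> i tt = X \<and> i ff = {}"

text \<open>Only the values at pairs with \<open>U \<in> \<O>\<close> and \<open>x \<in> U\<close> are meaningful; the clauses
  evaluate subformulas at such pairs only, when started from one. The carrier \<open>X\<close> of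
  the model enters only through the interpretation.\<close>

fun sat :: "'x set set \<Rightarrow> ('a \<Rightarrow> 'x set) \<Rightarrow> 'x \<Rightarrow> 'x set \<Rightarrow> 'a formula \<Rightarrow> bool" where
  "sat \<O> i x U (Atom a) \<longleftrightarrow> x \<in> i a"
| "sat \<O> i x U (Conj \<phi> \<psi>) \<longleftrightarrow> sat \<O> i x U \<phi> \<and> sat \<O> i x U \<psi>"
| "sat \<O> i x U (Neg \<phi>) \<longleftrightarrow> \<not> sat \<O> i x U \<phi>"
| "sat \<O> i x U (Know \<phi>) \<longleftrightarrow> (\<forall>y\<in>U. sat \<O> i y U \<phi>)"
| "sat \<O> i x U (Box \<phi>) \<longleftrightarrow> (\<forall>V\<in>\<O>. V \<subseteq> U \<and> x \<in> V \<longrightarrow> sat \<O> i x V \<phi>)"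

definition valid_in :: "'x set set \<Rightarrow> ('a \<Rightarrow> 'x set) \<Rightarrow> 'a formula \<Rightarrow> bool" where
  "valid_in \<O> i \<phi> \<longleftrightarrow> (\<forall>U\<in>\<O>. \<forall>x\<in>U. sat \<O> i x U \<phi>)"

text \<open>The analogue of \<^const>\<open>topological_basis\<close> for topologies with an explicit carrier.\<close>

definition basis_of :: "'x topology \<Rightarrow> 'x set set \<Rightarrow> bool" where
  "basis_of T \<B> \<longleftrightarrow>
     (\<forall>V\<in>\<B>. openin T V) \<and> (\<forall>U. openin T U \<longrightarrow> (\<exists>\<B>'\<subseteq>\<B>. \<Union>\<B>' = U))"

text \<open>The empty union is left out, so the empty set need not belong to the family.\<close>

definition closed_under_finite_unions :: "'x set set \<Rightarrow> bool" where
  "closed_under_finite_unions \<B> \<longleftrightarrow>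
     (\<forall>\<F>. finite \<F> \<and> \<F> \<noteq> {} \<and> \<F> \<subseteq> \<B> \<longrightarrow> \<Union>\<F> \<in> \<B>)"

end

theory Submission
  imports Defs
begin

text \<open>
  For every formula there is a finite family \<open>\<F>\<close> of sets such that the truth of the formula at
  \<open>(x, U)\<close>, for a fixed point \<open>x\<close>, depends only on which members of \<open>\<F>\<close> contain the open set
  \<open>U\<close>; this is Georgatos' partition theorem. A basis closed under finite unions is dense for such
  finite information: every open \<open>U\<close> containing \<open>x\<close> has a basic subset containing \<open>x\<close> and, for
  each member of \<open>\<F>\<close> that does not contain \<open>U\<close>, a point of \<open>U\<close> outside that member.
\<close>

section \<open>Finite families deciding a formula\<close>

definition supersets_in :: "'x set set \<Rightarrow> 'x set \<Rightarrow> 'x set set" where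
  "supersets_in \<F> U = {W \<in> \<F>. U \<subseteq> W}"

definition decides_sat ::
    "'x topology \<Rightarrow> ('a \<Rightarrow> 'x set) \<Rightarrow> 'x set set \<Rightarrow> 'a formula \<Rightarrow> bool" where
  "decides_sat T i \<F> \<phi> \<longleftrightarrow>
     (\<forall>U V x. openin T U \<longrightarrow> openin T V \<longrightarrow> supersets_in \<F> U = supersets_in \<F> V \<longrightarrow>
        x \<in> U \<longrightarrow> x \<in> V \<longrightarrow>
        (sat {U. openin T U} i x U \<phi> \<longleftrightarrow> sat {U. openin T U} i x V \<phi>))"

lemma decides_satD:
  assumes "decides_sat T i \<F> \<phi>" "openin T U" "openin T V"
    and "supersets_in \<F> U = supersets_in \<F> V" "x \<in> U" "x \<in> V"
  shows "sat {U. openin T U} i x U \<phi> \<longleftrightarrow> sat {U. openin T U} i x V \<phi>"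
  using assms unfolding decides_sat_def by blast

lemma supersets_in_mono:
  assumes "supersets_in \<G> U = supersets_in \<G> V" "\<F> \<subseteq> \<G>"
  shows "supersets_in \<F> U = supersets_in \<F> V"
  using assms unfolding supersets_in_def by blast

lemma supersets_in_subset_iff:
  assumes "supersets_in \<F> U = supersets_in \<F> V" "W \<in> \<F>"
  shows "U \<subseteq> W \<longleftrightarrow> V \<subseteq> W"
  using assms unfolding supersets_in_def by blast

lemma decides_sat_mono:
  assumes "decides_sat T i \<F> \<phi>" "\<F> \<subseteq> \<G>"
  shows "decides_sat T i \<G> \<phi>"
  unfolding decides_sat_def
proof (intro allI impI)
  fix U V x
  assume UV: "openin T U" "openin T V" "supersets_in \<G> U = supersets_in \<G> V" "x \<in> U" "x \<in> V"
  show "sat {U. openin T U} i x U \<phi> \<longleftrightarrow> sat {U. openin T U} i x V \<phi>"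
    using decides_satD[OF assms(1) UV(1,2) supersets_in_mono[OF UV(3) assms(2)] UV(4,5)] .
qed

text \<open>\<open>bad \<G>\<close> collects the points refuting \<open>\<phi>\<close> in the class of open sets with
  \<open>supersets_in \<F> U = \<G>\<close>; for \<open>U\<close> in that class, \<open>Know \<phi>\<close> holds iff \<open>U\<close> avoids \<open>bad \<G>\<close>.\<close>

lemma decides_sat_Know:
  assumes fin: "finite \<F>" and dec: "decides_sat T i \<F> \<phi>"
  shows "\<exists>\<G>. finite \<G> \<and> decides_sat T i \<G> (Know \<phi>)"
proof -
  let ?S = "sat {U. openin T U} i"
  define bad where "bad \<G> = {y. \<exists>U. openin T U \<and> supersets_in \<F> U = \<G> \<and> y \<in> U \<and> \<not> ?S y U \<phi>}"
    for \<G>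
  \<comment> \<open>Keeping \<open>\<F>\<close> makes \<open>U\<close> and \<open>V\<close> fall
    into the same class; the complements turn avoidance of \<open>bad \<G>\<close> into an
    inclusion. Every class is a subset of \<open>\<F>\<close>, so finitely many complements
    suffice.\<close>
  let ?H = "\<F> \<union> (\<lambda>\<G>. - bad \<G>) ` Pow \<F>"
  have transfer: "?S x V (Know \<phi>)"
    if op: "openin T U" "openin T V" and eq: "supersets_in ?H U = supersets_in ?H V"
      and K: "?S x U (Know \<phi>)" for U V x
  proof -
    let ?G = "supersets_in \<F> U"
    have eqF: "supersets_in \<F> U = supersets_in \<F> V"
      by (rule supersets_in_mono[OF eq]) simp
    have "?G \<in> Pow \<F>"
      by (auto simp: supersets_in_def)
    then have iff: "U \<subseteq> - bad ?G \<longleftrightarrow> V \<subseteq> - bad ?G"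
      by (intro supersets_in_subset_iff[OF eq]) blast
    \<comment> \<open>A point of \<open>U\<close> in \<open>bad ?G\<close> refutes
      \<open>\<phi>\<close> at some open set of the same class, hence also at \<open>U\<close>
      because \<open>\<F>\<close> decides \<open>\<phi>\<close>; this contradicts
      \<open>K\<close>.\<close>
    have "U \<subseteq> - bad ?G"
    proof
      fix y assume y: "y \<in> U"
      show "y \<in> - bad ?G"
        using K y decides_satD[OF dec _ op(1) _ _ y] by (auto simp: bad_def)
    qed
    then have "V \<subseteq> - bad ?G"
      using iff by simp
    \<comment> \<open>A point of \<open>V\<close> refuting \<open>\<phi>\<close> would lie in
      \<open>bad ?G\<close>, with \<open>V\<close> itself as witness.\<close>
    then show ?thesis
      using op(2) eqF by (auto simp: bad_def)
  qed
  have "finite ?H"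
    using fin by simp
  moreover have "decides_sat T i ?H (Know \<phi>)"
    unfolding decides_sat_def by (intro allI impI iffI; rule transfer; simp)
  ultimately show ?thesis by blast
qed

text \<open>If \<open>V' \<subseteq> V\<close> and \<open>N\<close> is the interior of the intersection of the members of \<open>\<F>\<close> containing
  \<open>V'\<close>, then \<open>U \<inter> N\<close> is indistinguishable from \<open>V'\<close> as soon as \<open>U\<close> and \<open>V\<close> agree on the
  implications \<open>- N \<union> W\<close> for \<open>W \<in> \<F>\<close>.\<close>

lemma decides_sat_Box:
  assumes fin: "finite \<F>" and dec: "decides_sat T i \<F> \<phi>"
  shows "\<exists>\<G>. finite \<G> \<and> decides_sat T i \<G> (Box \<phi>)"
proof -
  let ?S = "sat {U. openin T U} i"
  \<comment> \<open>With \<open>N\<close> the interior of \<open>\<Inter>\<G>\<close>,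
    \<open>U \<subseteq> imp (\<G>, W)\<close> says \<open>U \<inter> N \<subseteq> W\<close>. All
    subsets \<open>\<G>\<close> of \<open>\<F>\<close> are included, since the class of the later
    \<open>V'\<close> can be any of them.\<close>
  define imp where "imp = (\<lambda>(\<G>, W). - (T interior_of \<Inter>\<G>) \<union> W)"
  let ?H = "imp ` (Pow \<F> \<times> \<F>)"
  have transfer: "?S x V (Box \<phi>)"
    if op: "openin T U" "openin T V" and x: "x \<in> U"
      and eq: "supersets_in ?H U = supersets_in ?H V" and B: "?S x U (Box \<phi>)" for U V x
  proof -
    have "?S x V' \<phi>" if V': "openin T V'" "V' \<subseteq> V" "x \<in> V'" for V'
    proof -
      let ?G = "supersets_in \<F> V'"
      let ?N = "T interior_of \<Inter>?G"
      have N: "V' \<subseteq> ?N"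
        using V'(1) by (intro interior_of_maximal) (auto simp: supersets_in_def)
      have opU': "openin T (U \<inter> ?N)"
        using op(1) by (intro openin_Int openin_interior_of)
      have "U \<inter> ?N \<subseteq> W \<longleftrightarrow> V' \<subseteq> W" if W: "W \<in> \<F>" for W
      proof
        assume "U \<inter> ?N \<subseteq> W"
        then have "U \<subseteq> imp (?G, W)"
          by (auto simp: imp_def)
        moreover have "imp (?G, W) \<in> ?H"
          using W by (auto simp: supersets_in_def)
        ultimately have "V \<subseteq> imp (?G, W)"
          using supersets_in_subset_iff[OF eq] by metis
        then show "V' \<subseteq> W"
          using N V'(2) by (auto simp: imp_def)
      next
        assume "V' \<subseteq> W"
        then have "\<Inter>?G \<subseteq> W"
          using W by (auto simp: supersets_in_def)
        then show "U \<inter> ?N \<subseteq> W"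
          using interior_of_subset[of T "\<Inter>?G"] by blast
      qed
      then have "supersets_in \<F> (U \<inter> ?N) = ?G"
        by (auto simp: supersets_in_def)
      moreover have "?S x (U \<inter> ?N) \<phi>"
        using B opU' x N V'(3) by auto
      ultimately show ?thesis
        using decides_satD[OF dec opU' V'(1)] x N V'(3) by blast
    qed
    then show ?thesis by simp
  qed
  have "finite ?H"
    using fin by simp
  moreover have "decides_sat T i ?H (Box \<phi>)"
    unfolding decides_sat_def by (intro allI impI iffI; rule transfer; simp)
  ultimately show ?thesis by blast
qed

text \<open>Atoms depend on \<open>x\<close> alone, so the empty family decides them; negation keeps
  the family and conjunction takes a union.\<close>

theorem finite_decides_sat: "\<exists>\<F>. finite \<F> \<and> decides_sat T i \<F> \<phi>"
proof (induction \<phi>)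
  case (Atom a)
  have "decides_sat T i {} (Atom a)"
    by (simp add: decides_sat_def)
  then show ?case by blast
next
  case (Conj \<phi> \<psi>)
  then obtain \<F> \<G> where "finite \<F>" "decides_sat T i \<F> \<phi>" "finite \<G>" "decides_sat T i \<G> \<psi>"
    by blast
  then have "finite (\<F> \<union> \<G>)" "decides_sat T i (\<F> \<union> \<G>) \<phi>" "decides_sat T i (\<F> \<union> \<G>) \<psi>"
    using decides_sat_mono by (blast, blast, blast)
  moreover from this have "decides_sat T i (\<F> \<union> \<G>) (Conj \<phi> \<psi>)"
    unfolding decides_sat_def sat.simps by metis
  ultimately show ?case by blast
next
  case (Neg \<phi>)
  then show ?case by (simp add: decides_sat_def)
next
  case (Box \<phi>)
  then show ?case using decides_sat_Box by blast
next
  case (Know \<phi>)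
  then show ?case using decides_sat_Know by blast
qed

section \<open>Approximating open sets by basic sets\<close>

lemma basis_ofE:
  assumes "basis_of T \<B>" "openin T U" "x \<in> U"
  obtains V where "V \<in> \<B>" "x \<in> V" "V \<subseteq> U"
proof -
  obtain \<B>' where "\<B>' \<subseteq> \<B>" "\<Union>\<B>' = U"
    using assms(1,2) unfolding basis_of_def by blast
  then show ?thesis
    using assms(3) that by blast
qed

lemma basis_of_approximation:
  assumes basis: "basis_of T \<B>" and unions: "closed_under_finite_unions \<B>"
    and fin: "finite \<F>" and U: "openin T U" "x \<in> U"
  obtains V where "V \<in> \<B>" "x \<in> V" "V \<subseteq> U" "supersets_in \<F> V = supersets_in \<F> U"
proof -
  have "\<forall>y\<in>U. \<exists>V\<in>\<B>. y \<in> V \<and> V \<subseteq> U"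
    using basis_ofE[OF basis U(1)] by metis
  then obtain nb where nb: "\<And>y. y \<in> U \<Longrightarrow> nb y \<in> \<B> \<and> y \<in> nb y \<and> nb y \<subseteq> U"
    by metis
  have "\<forall>W. \<exists>y. \<not> U \<subseteq> W \<longrightarrow> y \<in> U - W"
    by blast
  then obtain pt where pt: "\<And>W. \<not> U \<subseteq> W \<Longrightarrow> pt W \<in> U - W"
    by metis
  \<comment> \<open>Including \<open>x\<close> puts it into \<open>?V\<close> and keeps the union
    nonempty, as the closure condition demands; each \<open>pt W\<close> keeps \<open>?V\<close>
    from lying inside \<open>W\<close>.\<close>
  let ?P = "insert x (pt ` {W \<in> \<F>. \<not> U \<subseteq> W})"
  let ?V = "\<Union>(nb ` ?P)"
  have P: "finite ?P" "?P \<subseteq> U"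
    using fin U(2) pt by auto
  then have "finite (nb ` ?P)" "nb ` ?P \<noteq> {}" "nb ` ?P \<subseteq> \<B>"
    using nb by (blast, blast, blast)
  then have V: "?V \<in> \<B>"
    using unions unfolding closed_under_finite_unions_def by blast
  have PV: "?P \<subseteq> ?V"
    using nb P(2) by blast
  have VU: "?V \<subseteq> U"
    using nb P(2) by blast
  have "?V \<subseteq> W \<longleftrightarrow> U \<subseteq> W" if "W \<in> \<F>" for W
  proof
    assume VW: "?V \<subseteq> W"
    show "U \<subseteq> W"
    proof (rule ccontr)
      assume "\<not> U \<subseteq> W"
      then have "pt W \<in> ?P" "pt W \<notin> W"
        using pt that by (blast, blast)
      then show False
        using PV VW by blast
    qed
  next
    assume "U \<subseteq> W"
    then show "?V \<subseteq> W"
      using VU by (rule order_trans[rotated])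
  qed
  then have "supersets_in \<F> ?V = supersets_in \<F> U"
    unfolding supersets_in_def by blast
  moreover have "x \<in> ?V"
    using PV by simp
  ultimately show ?thesis
    using that[OF V _ VU] by simp
qed

section \<open>Comparing the topology with the basis\<close>

lemma sat_basic_subset:
  assumes "basis_of T \<B>" "closed_under_finite_unions \<B>" "openin T U" "x \<in> U"
  obtains V where "V \<in> \<B>" "x \<in> V" "V \<subseteq> U"
    "sat {U. openin T U} i x V \<phi> \<longleftrightarrow> sat {U. openin T U} i x U \<phi>"
proof -
  obtain \<F> where F: "finite \<F>" "decides_sat T i \<F> \<phi>"
    using finite_decides_sat by blast
  obtain V where V: "V \<in> \<B>" "x \<in> V" "V \<subseteq> U" "supersets_in \<F> V = supersets_in \<F> U"
    using basis_of_approximation[OF assms(1,2) F(1) assms(3,4)] .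
  moreover have "openin T V"
    using assms(1) V(1) unfolding basis_of_def by blast
  ultimately show ?thesis
    using that decides_satD[OF F(2)] assms(3,4) by metis
qed

text \<open>Only \<open>Box\<close> needs an argument: \<open>Know\<close> ranges over the same
  \<open>V\<close> in both models, while \<open>Box\<close> over \<open>\<B>\<close> inspects basic
  subsets only.\<close>

lemma sat_basis_iff:
  assumes basis: "basis_of T \<B>" and unions: "closed_under_finite_unions \<B>"
    and "V \<in> \<B>" "x \<in> V"
  shows "sat \<B> i x V \<phi> \<longleftrightarrow> sat {U. openin T U} i x V \<phi>"
  using assms(3,4)
proof (induction \<phi> arbitrary: x V)
  case (Box \<phi>)
  have op: "openin T W" if "W \<in> \<B>" for W
    using basis that unfolding basis_of_def by blast
  show ?case
  proof
    assume B: "sat \<B> i x V (Box \<phi>)"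
    have "sat {U. openin T U} i x W \<phi>" if W: "openin T W" "W \<subseteq> V" "x \<in> W" for W
    proof -
      \<comment> \<open>\<open>W\<close> need not be basic, so the induction hypothesis is used at a
        basic \<open>V'\<close> inside \<open>W\<close> where \<open>\<phi>\<close> has the same
        truth value.\<close>
      obtain V' where V': "V' \<in> \<B>" "x \<in> V'" "V' \<subseteq> W"
        "sat {U. openin T U} i x V' \<phi> \<longleftrightarrow> sat {U. openin T U} i x W \<phi>"
        using sat_basic_subset[OF basis unions W(1,3)] .
      moreover have "sat \<B> i x V' \<phi>"
        using B V'(1-3) W(2) by auto
      ultimately show ?thesis
        using Box.IH by blast
    qed
    then show "sat {U. openin T U} i x V (Box \<phi>)" by simp
  next
    assume "sat {U. openin T U} i x V (Box \<phi>)"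
    then show "sat \<B> i x V (Box \<phi>)"
      using Box.IH op by auto
  qed
qed auto

theorem mainTheorem3:
  fixes T :: "'x topology"
    and \<B> :: "'x set set"
    and tt ff :: "'a :: countable"
    and i :: "'a \<Rightarrow> 'x set"
    and \<phi> :: "'a formula"
  assumes "basis_of T \<B>"
    and "closed_under_finite_unions \<B>"
    and "tt \<noteq> ff"
    and "initial_interpretation (topspace T) tt ff i"
  shows "valid_in {U. openin T U} i \<phi> \<longleftrightarrow> valid_in \<B> i \<phi>"
proof
  assume valid: "valid_in {U. openin T U} i \<phi>"
  have "sat \<B> i x V \<phi>" if V: "V \<in> \<B>" "x \<in> V" for V x
  proof -
    have "openin T V"
      using assms(1) V(1) unfolding basis_of_def by blast
    then show ?thesis
      unfolding sat_basis_iff[OF assms(1,2) V] using valid V(2) by (simp add: valid_in_def)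
  qed
  then show "valid_in \<B> i \<phi>"
    by (simp add: valid_in_def)
next
  assume valid: "valid_in \<B> i \<phi>"
  have "sat {U. openin T U} i x U \<phi>" if U: "openin T U" "x \<in> U" for U x
  proof -
    \<comment> \<open>A refutation at an arbitrary open \<open>U\<close> would persist at this basic
      \<open>V\<close>.\<close>
    obtain V where V: "V \<in> \<B>" "x \<in> V" and "V \<subseteq> U"
      and eq: "sat {U. openin T U} i x V \<phi> \<longleftrightarrow> sat {U. openin T U} i x U \<phi>"
      using sat_basic_subset[OF assms(1,2) U] .
    have "sat \<B> i x V \<phi>"
      using valid V by (simp add: valid_in_def)
    then show ?thesis
      unfolding sat_basis_iff[OF assms(1,2) V] eq .
  qed
  then show "valid_in {U. openin T U} i \<phi>"
    by (simp add: valid_in_def)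
qed

end
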